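(* The following two identities form a basis for the variety of ŁBCK-algebras, regarded as algebras $(A,\rightarrow)$ of type $\langle 2\rangle$: $$(x \rightarrow x) \rightarrow y = y \tag{L1}$$ $$((x\rightarrow y)\rightarrow (z\rightarrow x))\rightarrow (y\rightarrow x) = (x\rightarrow z)\rightarrow (y\rightarrow z). \tag{L2}$$ That is: an algebra $(A,\rightarrow)$ with one binary operation (with $A$ nonempty) is an ŁBCK-algebra if and only if it satisfies (L1) for all $x,y\in A$ and (L2) for all $x,y,z\in A$; moreover the two identities are independent, i.e. there is an algebra of type $\langle 2\rangle$ satisfying (L1) but not (L2), and one satisfying (L2) but not (L1).
   Context: All algebras have nonempty carrier. A commutative BCK-algebra (with constant) is an algebra $(A,\rightarrow,1)$ of type $\langle 2,0\rangle$ satisfying, for all $x,y,z\in A$: (B1) $(x\rightarrow y)\rightarrow y = (y\rightarrow x)\rightarrow x$; (B2) $x\rightarrow (y\rightarrow z) = y\rightarrow (x\rightarrow z)$; (B3) $x\rightarrow x = 1$; (B4) $1\rightarrow x = x$. By (B3) the constant $1$ is determined by $\rightarrow$ and may be dropped from the signature: an algebra $(A,\rightarrow)$ of type $\langle 2\rangle$ is called a commutative BCK-algebra if it satisfies (B1), (B2), $x\rightarrow x = y\rightarrow y$, and $(x\rightarrow x)\rightarrow y = y$ for all $x,y,z\in A$ (equivalently, there is an element $1\in A$ such that $(A,\rightarrow,1)$ satisfies (B1)--(B4)). The variety of ŁBCK-algebras ("Ł" for Łukasiewicz) is the subvariety of commutative BCK-algebras axiomatized by adding the identity (B5) $(x\rightarrow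 y)\rightarrow (y\rightarrow x) = y\rightarrow x$. So $(A,\rightarrow)$ is an ŁBCK-algebra if and only if it is a commutative BCK-algebra satisfying (B5). (The name originates from the known equivalent description, which is not to be proved here: ŁBCK-algebras are the $\rightarrow$-subreducts of bounded commutative BCK-algebras, i.e. of those having a bottom element with respect to the join semilattice order given by $x\vee y=(x\rightarrow y)\rightarrow y$.) A set of identities is a basis for a variety if the identities are independent (no one of them follows from the others) and the algebras of the given type satisfying all of them are exactly the members of the variety. *)

theory Defs
  imports Main
begin

locale binary_algebra =
  fixes A :: "'a set" and imp :: "'a \<Rightarrow> 'a \<Rightarrow> 'a" (infixr "\<rightarrow>" 65)
  assumes carrier_nonempty: "A \<noteq> {}"
    and imp_closed: "\<lbrakk>x \<in> A; y \<in> A\<rbrakk> \<Longrightarrow> x \<rightarrow> y \<in> A"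

text \<open>Commutative BCK-algebras in the signature without the constant, which is recovered as the
  common value of all \<open>x \<rightarrow> x\<close>.\<close>

locale commutative_BCK_algebra = binary_algebra +
  assumes B1: "\<lbrakk>x \<in> A; y \<in> A\<rbrakk> \<Longrightarrow> (x \<rightarrow> y) \<rightarrow> y = (y \<rightarrow> x) \<rightarrow> x"
    and B2: "\<lbrakk>x \<in> A; y \<in> A; z \<in> A\<rbrakk> \<Longrightarrow> x \<rightarrow> (y \<rightarrow> z) = y \<rightarrow> (x \<rightarrow> z)"
    and B3: "\<lbrakk>x \<in> A; y \<in> A\<rbrakk> \<Longrightarrow> x \<rightarrow> x = y \<rightarrow> y"
    and B4: "\<lbrakk>x \<in> A; y \<in> A\<rbrakk> \<Longrightarrow> (x \<rightarrow> x) \<rightarrow> y = y"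

locale LBCK_algebra = commutative_BCK_algebra +
  assumes B5: "\<lbrakk>x \<in> A; y \<in> A\<rbrakk> \<Longrightarrow> (x \<rightarrow> y) \<rightarrow> (y \<rightarrow> x) = y \<rightarrow> x"

context
  fixes A :: "'a set" and imp :: "'a \<Rightarrow> 'a \<Rightarrow> 'a" (infixr "\<rightarrow>" 65)
begin

definition satisfies_L1 :: bool where
  "satisfies_L1 \<longleftrightarrow> (\<forall>x\<in>A. \<forall>y\<in>A. (x \<rightarrow> x) \<rightarrow> y = y)"

definition satisfies_L2 :: bool where
  "satisfies_L2 \<longleftrightarrow> (\<forall>x\<in>A. \<forall>y\<in>A. \<forall>z\<in>A.
     ((x \<rightarrow> y) \<rightarrow> (z \<rightarrow> x)) \<rightarrow> (y \<rightarrow> x) = (x \<rightarrow> z) \<rightarrow> (y \<rightarrow> z))"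

end

end

theory Submission
  imports Defs
begin

text \<open>From (L1) and (L2) one first gets (B1): each \<open>x \<rightarrow> (x \<rightarrow> x)\<close> is a left unit by (L2), and
  substituting \<open>x \<rightarrow> x\<close> for \<open>y\<close> in (L2) gives (B1). This in turn yields
  \<open>(z \<rightarrow> x) \<rightarrow> (z \<rightarrow> x) = x \<rightarrow> x\<close>, and with (L2) all the left units \<open>x \<rightarrow> x\<close> coincide. Write
  \<open>\<one>\<close> for the common value and \<open>x \<le> y\<close> for \<open>x \<rightarrow> y = \<one>\<close>, which is antisymmetric by (B1). Then (L2)
  makes \<open>\<rightarrow>\<close> antitone in its first argument, and exchange and (B5) follow by antisymmetry.

  Conversely, in a commutative BCK-algebra the right-hand side of (L2) equals
  \<open>(z \<rightarrow> x) \<rightarrow> (y \<rightarrow> x)\<close>. Put \<open>s = x \<rightarrow> y\<close>, \<open>t = y \<rightarrow> x\<close>, \<open>w = z \<rightarrow> x\<close>; then (B5) says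
  \<open>s \<rightarrow> t = t\<close>, so \<open>s \<rightarrow> w \<le> (w \<rightarrow> t) \<rightarrow> (s \<rightarrow> t) = (w \<rightarrow> t) \<rightarrow> t\<close>, which is
  \<open>w \<rightarrow> t \<le> (s \<rightarrow> w) \<rightarrow> t\<close>; the reverse inequality holds because \<open>w \<le> s \<rightarrow> w\<close>.\<close>

text \<open>The constant is a parameter here, so that both directions share antisymmetry.\<close>

locale unital_join_algebra = binary_algebra +
  fixes one :: 'a ("\<one>")
  assumes one_closed: "\<one> \<in> A"
    and imp_self: "x \<in> A \<Longrightarrow> x \<rightarrow> x = \<one>"
    and one_imp: "x \<in> A \<Longrightarrow> \<one> \<rightarrow> x = x"
    and join_commute: "\<lbrakk>x \<in> A; y \<in> A\<rbrakk> \<Longrightarrow> (x \<rightarrow> y) \<rightarrow> y = (y \<rightarrow> x) \<rightarrow> x"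
begin

lemmas [simp] = imp_closed one_closed imp_self one_imp

lemma imp_antisym:
  assumes "x \<in> A" "y \<in> A" "x \<rightarrow> y = \<one>" "y \<rightarrow> x = \<one>"
  shows "x = y"
  using join_commute[of x y] assms by simp

end

locale unital_BCK_algebra = unital_join_algebra +
  assumes exchange: "\<lbrakk>x \<in> A; y \<in> A; z \<in> A\<rbrakk> \<Longrightarrow> x \<rightarrow> (y \<rightarrow> z) = y \<rightarrow> (x \<rightarrow> z)"
begin

lemma imp_one [simp]:
  assumes [simp]: "x \<in> A"
  shows "x \<rightarrow> \<one> = \<one>"
proof -
  have "x \<rightarrow> \<one> = x \<rightarrow> ((x \<rightarrow> \<one>) \<rightarrow> \<one>)"
    by (simp add: join_commute[of x \<one>])
  also have "\<dots> = (x \<rightarrow> \<one>) \<rightarrow> (x \<rightarrow> \<one>)"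
    by (rule exchange) simp_all
  also have "\<dots> = \<one>" by simp
  finally show ?thesis .
qed

lemma imp_weaken [simp]:
  assumes [simp]: "x \<in> A" "y \<in> A"
  shows "x \<rightarrow> (y \<rightarrow> x) = \<one>"
  by (simp add: exchange[of x y x])

text \<open>Exchange makes each side \<open>y\<close> implying a join of \<open>x\<close> and
  \<open>z\<close>, and joins commute.\<close>

lemma imp_imp_swap:
  assumes [simp]: "x \<in> A" "y \<in> A" "z \<in> A"
  shows "(x \<rightarrow> z) \<rightarrow> (y \<rightarrow> z) = (z \<rightarrow> x) \<rightarrow> (y \<rightarrow> x)"
proof -
  have "(x \<rightarrow> z) \<rightarrow> (y \<rightarrow> z) = y \<rightarrow> ((x \<rightarrow> z) \<rightarrow> z)"
    by (rule exchange) simp_all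
  also have "\<dots> = y \<rightarrow> ((z \<rightarrow> x) \<rightarrow> x)"
    by (simp add: join_commute[of x z])
  also have "\<dots> = (z \<rightarrow> x) \<rightarrow> (y \<rightarrow> x)"
    by (rule exchange) simp_all
  finally show ?thesis .
qed

lemma imp_trans:
  assumes [simp]: "x \<in> A" "y \<in> A" "z \<in> A"
  shows "(y \<rightarrow> x) \<rightarrow> ((x \<rightarrow> z) \<rightarrow> (y \<rightarrow> z)) = \<one>"
  by (simp add: imp_imp_swap[of x y z])

lemma L2_if_prelinear:
  assumes prelinear: "\<And>x y. \<lbrakk>x \<in> A; y \<in> A\<rbrakk> \<Longrightarrow> (x \<rightarrow> y) \<rightarrow> (y \<rightarrow> x) = y \<rightarrow> x"
    and [simp]: "x \<in> A" "y \<in> A" "z \<in> A"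
  shows "((x \<rightarrow> y) \<rightarrow> (z \<rightarrow> x)) \<rightarrow> (y \<rightarrow> x) = (x \<rightarrow> z) \<rightarrow> (y \<rightarrow> z)"
proof -
  define s t w where "s = x \<rightarrow> y" and "t = y \<rightarrow> x" and "w = z \<rightarrow> x"
  have [simp]: "s \<in> A" "t \<in> A" "w \<in> A"
    by (simp_all add: s_def t_def w_def)
  have st: "s \<rightarrow> t = t"
    by (simp add: s_def t_def prelinear)
  have "(s \<rightarrow> w) \<rightarrow> t = w \<rightarrow> t"
  proof (rule imp_antisym)
    show "((s \<rightarrow> w) \<rightarrow> t) \<rightarrow> (w \<rightarrow> t) = \<one>"
      using imp_trans[of "s \<rightarrow> w" w t] by simp
    have "(w \<rightarrow> t) \<rightarrow> ((s \<rightarrow> w) \<rightarrow> t) = (s \<rightarrow> w) \<rightarrow> ((w \<rightarrow> t) \<rightarrow> t)"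
      by (rule exchange) simp_all
    also have "\<dots> = \<one>"
      using imp_trans[of w s t] by (simp add: st)
    finally show "(w \<rightarrow> t) \<rightarrow> ((s \<rightarrow> w) \<rightarrow> t) = \<one>" .
  qed simp_all
  then show ?thesis
    by (simp add: s_def t_def w_def imp_imp_swap[of x y z])
qed

end

locale unital_L2_algebra = unital_join_algebra +
  assumes L2: "\<lbrakk>x \<in> A; y \<in> A; z \<in> A\<rbrakk> \<Longrightarrow>
    ((x \<rightarrow> y) \<rightarrow> (z \<rightarrow> x)) \<rightarrow> (y \<rightarrow> x) = (x \<rightarrow> z) \<rightarrow> (y \<rightarrow> z)"
    and imp_one: "x \<in> A \<Longrightarrow> x \<rightarrow> \<one> = \<one>"
begin

lemmas [simp] = imp_one

lemma imp_weaken [simp]: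
  assumes "x \<in> A" "y \<in> A"
  shows "x \<rightarrow> (y \<rightarrow> x) = \<one>"
  using L2[of \<one> y x] assms by simp

lemma imp_antitone:
  assumes "x \<in> A" "y \<in> A" "z \<in> A" "x \<rightarrow> y = \<one>"
  shows "(y \<rightarrow> z) \<rightarrow> (x \<rightarrow> z) = \<one>"
  using L2[of y x z] assms by simp

text \<open>With \<open>x \<rightarrow> y\<close> as first variable of \<open>L2\<close>, weakening
  and \<open>imp_one\<close> reduce the antecedent on the left of \<open>L2\<close> to
  \<one>.\<close>

lemma imp_join_imp:
  assumes "x \<in> A" "y \<in> A" "z \<in> A"
  shows "((x \<rightarrow> y) \<rightarrow> y) \<rightarrow> (z \<rightarrow> y) = z \<rightarrow> (x \<rightarrow> y)"
  using L2[of "x \<rightarrow> y" z y] assms by simp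

lemma exchange_le:
  assumes [simp]: "x \<in> A" "y \<in> A" "z \<in> A"
  shows "(z \<rightarrow> (x \<rightarrow> y)) \<rightarrow> (x \<rightarrow> (z \<rightarrow> y)) = \<one>"
proof -
  \<comment> \<open>\<open>x\<close> lies below its join with \<open>y\<close>; antitonicity
    applies, and \<open>imp_join_imp\<close> removes the join.\<close>
  have "x \<rightarrow> ((x \<rightarrow> y) \<rightarrow> y) = \<one>"
    by (simp add: join_commute[of x y])
  then show ?thesis
    using imp_antitone[of x "(x \<rightarrow> y) \<rightarrow> y" "z \<rightarrow> y"] by (simp add: imp_join_imp)
qed

lemma exchange:
  assumes "x \<in> A" "y \<in> A" "z \<in> A"
  shows "x \<rightarrow> (y \<rightarrow> z) = y \<rightarrow> (x \<rightarrow> z)"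
  by (rule imp_antisym) (use assms in \<open>simp_all add: exchange_le\<close>)

lemma prelinear:
  assumes [simp]: "x \<in> A" "y \<in> A"
  shows "(x \<rightarrow> y) \<rightarrow> (y \<rightarrow> x) = y \<rightarrow> x"
  \<comment> \<open>This instance of \<open>L2\<close> has right-hand side \<one>; the converse
    inequality is weakening.\<close>
  by (rule imp_antisym) (use L2[of x y y] in simp_all)

end

locale L1_L2_algebra = binary_algebra +
  assumes L1: "\<lbrakk>x \<in> A; y \<in> A\<rbrakk> \<Longrightarrow> (x \<rightarrow> x) \<rightarrow> y = y"
    and L2: "\<lbrakk>x \<in> A; y \<in> A; z \<in> A\<rbrakk> \<Longrightarrow>
    ((x \<rightarrow> y) \<rightarrow> (z \<rightarrow> x)) \<rightarrow> (y \<rightarrow> x) = (x \<rightarrow> z) \<rightarrow> (y \<rightarrow> z)"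
begin

lemmas [simp] = imp_closed L1

lemma imp_imp_self:
  assumes "x \<in> A" "z \<in> A"
  shows "(z \<rightarrow> x) \<rightarrow> (x \<rightarrow> x) = (x \<rightarrow> z) \<rightarrow> (x \<rightarrow> z)"
  using L2[of x x z] assms by simp

lemma imp_self_left_unit:
  assumes [simp]: "x \<in> A" "y \<in> A"
  shows "(x \<rightarrow> (x \<rightarrow> x)) \<rightarrow> y = y"
proof -
  \<comment> \<open>This element \<open>u\<close> satisfies \<open>u \<rightarrow> u = u\<close>, so
    \<open>L1\<close> for \<open>u\<close> makes it a left unit.\<close>
  have "(x \<rightarrow> (x \<rightarrow> x)) \<rightarrow> (x \<rightarrow> (x \<rightarrow> x)) = x \<rightarrow> (x \<rightarrow> x)"
    using imp_imp_self[of x "x \<rightarrow> x", symmetric] by simp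
  then show ?thesis
    using L1[of "x \<rightarrow> (x \<rightarrow> x)" y] by (simp del: L1)
qed

lemma join_commute:
  assumes "x \<in> A" "y \<in> A"
  shows "(x \<rightarrow> y) \<rightarrow> y = (y \<rightarrow> x) \<rightarrow> x"
  using L2[of x "x \<rightarrow> x" y] assms by (simp add: imp_self_left_unit)

text \<open>The join of \<open>z \<rightarrow> x\<close> and \<open>x \<rightarrow> x\<close>, taken
  in both orders, gives the two sides.\<close>

lemma imp_self_imp:
  assumes [simp]: "x \<in> A" "z \<in> A"
  shows "(z \<rightarrow> x) \<rightarrow> (z \<rightarrow> x) = x \<rightarrow> x"
  using join_commute[of "z \<rightarrow> x" "x \<rightarrow> x"] by (simp add: imp_imp_self)

text \<open>If \<open>u = v \<rightarrow> (x \<rightarrow> x)\<close> is a left unit, then \<open>u = u \<rightarrow> u = x \<rightarrow> x\<close>.\<close>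

lemma left_unit_eq:
  assumes [simp]: "x \<in> A" "v \<in> A"
    and unit: "\<And>y. y \<in> A \<Longrightarrow> (v \<rightarrow> (x \<rightarrow> x)) \<rightarrow> y = y"
  shows "v \<rightarrow> (x \<rightarrow> x) = x \<rightarrow> x"
  using imp_self_imp[of "x \<rightarrow> x" v] unit[of "v \<rightarrow> (x \<rightarrow> x)"] by simp

lemma imp_self_eq:
  assumes [simp]: "x \<in> A" "y \<in> A"
  shows "x \<rightarrow> x = y \<rightarrow> y"
proof -
  \<comment> \<open>The left side is also
    \<open>(x \<rightarrow> y) \<rightarrow> (x \<rightarrow> y)\<close>, hence a left unit, and it
    equals \<open>y \<rightarrow> y\<close>.\<close>
  have "(y \<rightarrow> x) \<rightarrow> (x \<rightarrow> x) = x \<rightarrow> x"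
    by (rule left_unit_eq) (simp_all add: imp_imp_self)
  then show ?thesis
    by (simp add: imp_imp_self imp_self_imp)
qed

lemma imp_imp_self_eq:
  assumes "x \<in> A"
  shows "x \<rightarrow> (x \<rightarrow> x) = x \<rightarrow> x"
  by (rule left_unit_eq) (use assms in \<open>simp_all add: imp_self_left_unit\<close>)

lemma LBCK: "LBCK_algebra A (\<rightarrow>)"
proof -
  obtain e where e: "e \<in> A" "\<And>x. x \<in> A \<Longrightarrow> x \<rightarrow> x = e"
    using carrier_nonempty imp_closed imp_self_eq by blast
  have left: "e \<rightarrow> x = x" if "x \<in> A" for x
    using L1[OF that that] e(2)[OF that] by simp
  have right: "x \<rightarrow> e = e" if "x \<in> A" for x
    using imp_imp_self_eq[OF that] e(2)[OF that] by simp
  interpret unital_L2_algebra A "(\<rightarrow>)" e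
    by unfold_locales (fact e left join_commute L2 right)+
  show ?thesis
  proof
    show "x \<rightarrow> x = y \<rightarrow> y" if "x \<in> A" "y \<in> A" for x y
      using that by (rule imp_self_eq)
  qed (fact join_commute exchange L1 prelinear)+
qed

end

lemma (in LBCK_algebra) L1_L2: "L1_L2_algebra A (\<rightarrow>)"
proof -
  obtain e where e: "e \<in> A" "\<And>x. x \<in> A \<Longrightarrow> x \<rightarrow> x = e"
    using carrier_nonempty imp_closed B3 by blast
  have left: "e \<rightarrow> x = x" if "x \<in> A" for x
    using B4[OF that that] e(2)[OF that] by simp
  interpret unital_BCK_algebra A "(\<rightarrow>)" e
    by unfold_locales (fact e left B1 B2)+
  show ?thesis
    by unfold_locales (fact B4, rule L2_if_prelinear[OF B5])
qed

lemma L1_L2_algebra_iff: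
  "L1_L2_algebra A imp \<longleftrightarrow> binary_algebra A imp \<and> satisfies_L1 A imp \<and> satisfies_L2 A imp"
  unfolding L1_L2_algebra_def L1_L2_algebra_axioms_def satisfies_L1_def satisfies_L2_def by blast

theorem theorem1p3:
  shows "(\<forall>(A :: 'a set) imp. binary_algebra A imp \<longrightarrow>
            (LBCK_algebra A imp \<longleftrightarrow> satisfies_L1 A imp \<and> satisfies_L2 A imp))
       \<and> (\<exists>(B :: nat set) imp. binary_algebra B imp \<and> satisfies_L1 B imp \<and> \<not> satisfies_L2 B imp)
       \<and> (\<exists>(C :: nat set) imp. binary_algebra C imp \<and> satisfies_L2 C imp \<and> \<not> satisfies_L1 C imp)"
proof (intro conjI allI impI)
  fix A :: "'a set" and imp
  assume "binary_algebra A imp"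
  then show "LBCK_algebra A imp \<longleftrightarrow> satisfies_L1 A imp \<and> satisfies_L2 A imp"
    using LBCK_algebra.L1_L2[of A imp] L1_L2_algebra.LBCK[of A imp] L1_L2_algebra_iff[of A imp]
    by blast
next
  \<comment> \<open>Under right projection the two sides of (L2) are \<open>x\<close> and
    \<open>z\<close>.\<close>
  have "binary_algebra {0, 1 :: nat} (\<lambda>x y. y) \<and> satisfies_L1 {0, 1 :: nat} (\<lambda>x y. y)
      \<and> \<not> satisfies_L2 {0, 1 :: nat} (\<lambda>x y. y)"
    by (auto simp: binary_algebra_def satisfies_L1_def satisfies_L2_def)
  then show "\<exists>(B :: nat set) imp. binary_algebra B imp \<and> satisfies_L1 B imp \<and> \<not> satisfies_L2 B imp"
    by blast
next
  \<comment> \<open>Under a constant operation both sides of (L2) are \<open>0\<close>, but (L1)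
    fails at \<open>y = 1\<close>.\<close>
  have "binary_algebra {0, 1 :: nat} (\<lambda>x y. 0) \<and> satisfies_L2 {0, 1 :: nat} (\<lambda>x y. 0)
      \<and> \<not> satisfies_L1 {0, 1 :: nat} (\<lambda>x y. 0)"
    by (auto simp: binary_algebra_def satisfies_L1_def satisfies_L2_def)
  then show "\<exists>(C :: nat set) imp. binary_algebra C imp \<and> satisfies_L2 C imp \<and> \<not> satisfies_L1 C imp"
    by blast
qed

end
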